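(* Let $\psi\not\equiv0$ and $\varphi$ be two entire functions such that $W_{\psi,\varphi,\max}$ is normal on $\mathcal F^2$; that is, $\varphi(z)=Az+B$ and $\psi(z)=Ce^{Dz}$ for complex constants $A,B,C,D$ such that either $A\neq1$ and $D=\overline B(1-A)(1-\overline A)^{-1}$, or $A=1$ and $|B|=|D|$. Then the operator $W_{\psi,\varphi,\max}$ is $\mathcal C$-selfadjoint with respect to the weighted composition conjugation $\mathcal C=\mathcal C_{a,b,c}$ given by $$b=0,\quad c=1,\quad a=\begin{cases}\overline B(1-A)B^{-1}(1-\overline A)^{-1},&\text{if }B\ne0,\ A\ne1,\\ DB^{-1},&\text{if }B\ne0,\ A=1,\\ 1,&\text{if }B=0.\end{cases}$$
   Context: The Fock space $\mathcal F^2$ is the Hilbert space of entire functions on $\mathbb C$ that are square integrable with respect to $\frac1\pi e^{-|z|^2}\,dV(z)$ ($dV$ is Lebesgue measure on $\mathbb C$), with inner product $\langle f,g\rangle=\frac1\pi\int_{\mathbb C}f(z)\overline{g(z)}e^{-|z|^2}\,dV(z)$. For entire functions $\psi,\varphi$, put $E(\psi,\varphi)f=\psi\cdot (f\circ\varphi)$. The maximal weighted composition operator $W_{\psi,\varphi,\max}$ has domain $\{f\in\mathcal F^2: E(\psi,\varphi)f\in\mathcal F^2\}$ and acts by $W_{\psi,\varphi,\max}f=E(\psi,\varphi)f$. An operator $T$ is normal if it is closed, densely defined, $\operatorname{dom}(T)=\operatorname{dom}(T^* )$ and $\|Tx\|=\|T^*x\|$ for all $x\in\operatorname{dom}(T)$.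 For complex numbers $a,b,c$ with $|a|=1$, $\bar ab+\bar b=0$, $|c|^2e^{|b|^2}=1$, the weighted composition conjugation is $\mathcal C_{a,b,c}f(z)=ce^{bz}\overline{f(\overline{az+b})}$, $f\in\mathcal F^2$; it is an anti-linear, isometric, involutive map on $\mathcal F^2$ (a conjugation). For a conjugation $\mathcal C$, $\operatorname{dom}(\mathcal CF\mathcal C)=\{f:\mathcal Cf\in\operatorname{dom}(F)\}$, and an operator $T$ is $\mathcal C$-selfadjoint if it is closed, densely defined, linear and $T=\mathcal CT^*\mathcal C$. *)

theory Defs
  imports "HOL-Complex_Analysis.Complex_Analysis"
begin

text \<open>Elements of the Fock space are honest entire functions, so equality in the Hilbert space is
  equality of functions.\<close>

definition fock :: "(complex \<Rightarrow> complex) set" where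
  "fock = {f. f holomorphic_on UNIV \<and>
              integrable lborel (\<lambda>z::complex. (norm (f z))\<^sup>2 * exp (- (norm z)\<^sup>2))}"

definition fock_inner :: "(complex \<Rightarrow> complex) \<Rightarrow> (complex \<Rightarrow> complex) \<Rightarrow> complex" where
  "fock_inner f g =
     complex_of_real (1 / pi) *
     (LINT z|lborel. f z * cnj (g z) * complex_of_real (exp (- (norm z)\<^sup>2)))"

definition fock_norm :: "(complex \<Rightarrow> complex) \<Rightarrow> real" where
  "fock_norm f = sqrt (Re (fock_inner f f))"

text \<open>A possibly unbounded operator on the Fock space: a domain together with an action, where only
  the values of the action on the domain are meaningful.\<close>

record fock_operator =
  op_dom :: "(complex \<Rightarrow> complex) set"
  op_app :: "(complex \<Rightarrow> complex) \<Rightarrow> (complex \<Rightarrow> complex)"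

definition op_eq :: "fock_operator \<Rightarrow> fock_operator \<Rightarrow> bool" where
  "op_eq S T \<longleftrightarrow> op_dom S = op_dom T \<and> (\<forall>f\<in>op_dom S. op_app S f = op_app T f)"

definition linear_op :: "fock_operator \<Rightarrow> bool" where
  "linear_op T \<longleftrightarrow>
     op_dom T \<subseteq> fock \<and> (\<forall>f\<in>op_dom T. op_app T f \<in> fock) \<and>
     (\<lambda>z. 0) \<in> op_dom T \<and>
     (\<forall>f\<in>op_dom T. \<forall>g\<in>op_dom T. \<forall>\<alpha> \<beta>.
        (\<lambda>z. \<alpha> * f z + \<beta> * g z) \<in> op_dom T \<and>
        op_app T (\<lambda>z. \<alpha> * f z + \<beta> * g z) = (\<lambda>z. \<alpha> * op_app T f z + \<beta> * op_app T g z))"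

definition densely_defined :: "fock_operator \<Rightarrow> bool" where
  "densely_defined T \<longleftrightarrow>
     (\<forall>f\<in>fock. \<forall>e>0. \<exists>g\<in>op_dom T. fock_norm (\<lambda>z. f z - g z) < e)"

definition closed_op :: "fock_operator \<Rightarrow> bool" where
  "closed_op T \<longleftrightarrow>
     (\<forall>X f g. (\<forall>n::nat. X n \<in> op_dom T) \<and> f \<in> fock \<and> g \<in> fock \<and>
        (\<lambda>n. fock_norm (\<lambda>z. X n z - f z)) \<longlonglongrightarrow> 0 \<and>
        (\<lambda>n. fock_norm (\<lambda>z. op_app T (X n) z - g z)) \<longlonglongrightarrow> 0
        \<longrightarrow> f \<in> op_dom T \<and> op_app T f = g)"

text \<open>The vector \<open>h\<close> below is unique when \<open>T\<close> is densely defined; the adjoint is only used for such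
  \<open>T\<close>.\<close>

definition adjoint_op :: "fock_operator \<Rightarrow> fock_operator" where
  "adjoint_op T =
     \<lparr> op_dom = {g\<in>fock. \<exists>h\<in>fock. \<forall>f\<in>op_dom T. fock_inner (op_app T f) g = fock_inner f h},
       op_app = (\<lambda>g. THE h. h \<in> fock \<and>
                   (\<forall>f\<in>op_dom T. fock_inner (op_app T f) g = fock_inner f h)) \<rparr>"

definition normal_op :: "fock_operator \<Rightarrow> bool" where
  "normal_op T \<longleftrightarrow>
     closed_op T \<and> densely_defined T \<and> op_dom T = op_dom (adjoint_op T) \<and>
     (\<forall>f\<in>op_dom T. fock_norm (op_app T f) = fock_norm (op_app (adjoint_op T) f))"

definition conjugation :: "((complex \<Rightarrow> complex) \<Rightarrow> (complex \<Rightarrow> complex)) \<Rightarrow> bool" where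
  "conjugation \<C> \<longleftrightarrow>
     (\<forall>f\<in>fock. \<C> f \<in> fock) \<and>
     (\<forall>f\<in>fock. \<forall>g\<in>fock. \<forall>\<alpha> \<beta>.
        \<C> (\<lambda>z. \<alpha> * f z + \<beta> * g z) = (\<lambda>z. cnj \<alpha> * \<C> f z + cnj \<beta> * \<C> g z)) \<and>
     (\<forall>f\<in>fock. fock_norm (\<C> f) = fock_norm f) \<and>
     (\<forall>f\<in>fock. \<C> (\<C> f) = f)"

definition conjugate_op ::
  "((complex \<Rightarrow> complex) \<Rightarrow> (complex \<Rightarrow> complex)) \<Rightarrow> fock_operator \<Rightarrow> fock_operator" where
  "conjugate_op \<C> T =
     \<lparr> op_dom = {f\<in>fock. \<C> f \<in> op_dom T}, op_app = (\<lambda>f. \<C> (op_app T (\<C> f))) \<rparr>"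

definition C_selfadjoint ::
  "((complex \<Rightarrow> complex) \<Rightarrow> (complex \<Rightarrow> complex)) \<Rightarrow> fock_operator \<Rightarrow> bool" where
  "C_selfadjoint \<C> T \<longleftrightarrow>
     conjugation \<C> \<and> closed_op T \<and> densely_defined T \<and> linear_op T \<and>
     op_eq T (conjugate_op \<C> (adjoint_op T))"

definition wcomp_expr ::
  "(complex \<Rightarrow> complex) \<Rightarrow> (complex \<Rightarrow> complex) \<Rightarrow> (complex \<Rightarrow> complex) \<Rightarrow> (complex \<Rightarrow> complex)" where
  "wcomp_expr \<psi> \<phi> f = (\<lambda>z. \<psi> z * f (\<phi> z))"

definition wcomp_max :: "(complex \<Rightarrow> complex) \<Rightarrow> (complex \<Rightarrow> complex) \<Rightarrow> fock_operator" where
  "wcomp_max \<psi> \<phi> =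
     \<lparr> op_dom = {f\<in>fock. wcomp_expr \<psi> \<phi> f \<in> fock}, op_app = wcomp_expr \<psi> \<phi> \<rparr>"

definition wcomp_conj_params :: "complex \<Rightarrow> complex \<Rightarrow> complex \<Rightarrow> bool" where
  "wcomp_conj_params a b c \<longleftrightarrow>
     norm a = 1 \<and> cnj a * b + cnj b = 0 \<and> (norm c)\<^sup>2 * exp ((norm b)\<^sup>2) = 1"

definition wcomp_conj ::
  "complex \<Rightarrow> complex \<Rightarrow> complex \<Rightarrow> (complex \<Rightarrow> complex) \<Rightarrow> (complex \<Rightarrow> complex)" where
  "wcomp_conj a b c f = (\<lambda>z. c * exp (b * z) * cnj (f (cnj (a * z + b))))"

end

theory Submission
  imports Defs "HOL-Probability.Distributions"
begin

text \<open>
  Write \<open>K\<^sub>w(z) = exp (z cnj w)\<close> for the reproducing kernel and \<open>T\<close> for the maximal operator. The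
  reproducing property gives \<open>T\<^sup>* K\<^sub>w = cnj (\<psi>(w)) K\<close> with \<open>K\<close> the kernel at \<open>\<phi>(w)\<close>, so normality forces
  \<open>K\<^sub>w \<in> dom T\<close> and \<open>\<parallel>T K\<^sub>w\<parallel> = |\<psi>(w)| exp (|\<phi>(w)|\<^sup>2 / 2)\<close>. The pointwise bound
  \<open>|f(z)| \<le> \<parallel>f\<parallel> exp (|z|\<^sup>2 / 2)\<close>, applied to \<open>T K\<^sub>w\<close>, becomes a single inequality in \<open>z\<close> and \<open>w\<close>. It shows
  that \<open>\<psi>\<close> has no zeros, and by Borel--Caratheodory that \<open>\<phi>\<close> and \<open>log \<psi>\<close> are polynomials of degree at
  most two; comparing leading terms removes the quadratic coefficients, and the linear terms at
  \<open>z = cnj A w\<close> give \<open>D (1 - cnj A) = cnj B (1 - A)\<close>. The norm identity at \<open>w = 0\<close> gives \<open>|B| = |D|\<close>.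

  Since all kernels lie in \<open>dom T\<close>, \<open>T\<^sup>*\<close> acts as the weighted composition with symbols
  \<open>cnj C exp (cnj B w)\<close> and \<open>cnj A w + cnj D\<close>, and the conjugation intertwines this expression with
  that of \<open>T\<close> because \<open>D = a B\<close>. Normality also makes \<open>dom T\<^sup>* = dom T\<close>, so the intertwining of the
  expressions alone shows that the conjugation preserves \<open>dom T\<close>; no core for \<open>T\<close> is needed.
\<close>

unbundle no fps_syntax

section \<open>Lebesgue measure on the complex plane\<close>

text \<open>Carries facts about orthogonal maps of \<open>real^2\<close> over to
  \<open>complex\<close>. Lebesgue measure is determined by its values on boxes, and the coordinate
  map pulls boxes back to boxes.\<close>

lemma distr_lborel_vec_complex:
  "distr lborel borel (\<lambda>v::real^2. Complex (v $ 1) (v $ 2)) = (lborel :: complex measure)"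
proof (rule lborel_eqI[symmetric])
  fix l u :: complex
  assume le: "\<And>b. b \<in> Basis \<Longrightarrow> l \<bullet> b \<le> u \<bullet> b"
  have [measurable]: "(\<lambda>v::real^2. Complex (v $ 1) (v $ 2)) \<in> borel_measurable borel"
    by (intro borel_measurable_continuous_onI continuous_intros)
  have "(\<lambda>v::real^2. Complex (v $ 1) (v $ 2)) -` box l u
      = box (vector [Re l, Im l]) (vector [Re u, Im u])"
    by (auto simp: box_def Basis_complex_def Basis_vec_def inner_axis forall_2)
  then show "emeasure (distr lborel borel (\<lambda>v::real^2. Complex (v $ 1) (v $ 2))) (box l u)
      = ennreal (\<Prod>b\<in>Basis. (u - l) \<bullet> b)"
    using le[of 1] le[of \<i>] by (simp add: emeasure_distr emeasure_lborel_box_eq Basis_complex_def Basis_vec_def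
        inner_axis forall_2 UNIV_2 axis_eq_axis)
qed simp

text \<open>In real coordinates the preimage of a box under \<open>f\<close> is the image of a box
  under an orthogonal map of \<open>real^2\<close>, and such maps preserve Lebesgue measure.\<close>

lemma distr_lborel_orthogonal_complex:
  fixes f :: "complex \<Rightarrow> complex"
  assumes "orthogonal_transformation f"
  shows "distr lborel borel f = lborel"
proof (rule lborel_eqI[symmetric])
  fix l u :: complex
  assume le: "\<And>b. b \<in> Basis \<Longrightarrow> l \<bullet> b \<le> u \<bullet> b"
  define h where "h = (\<lambda>v::real^2. Complex (v $ 1) (v $ 2))"
  define k where "k = (\<lambda>z. vector [Re z, Im z] :: real^2)"
  \<comment> \<open>The inverse of \<open>f\<close> enters because a preimage under \<open>f\<close>
    is an image under \<open>inv f\<close>.\<close>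
  define F where "F = k \<circ> inv f \<circ> h"
  have [measurable]: "h \<in> borel_measurable borel"
    unfolding h_def by (intro borel_measurable_continuous_onI continuous_intros)
  have hk: "h (k z) = z" and kh: "k (h v) = v" for z v
    by (auto simp: h_def k_def vec_eq_iff forall_2)
  have linf: "linear f"
    using assms by (simp add: orthogonal_transformation_linear)
  then have "continuous_on UNIV f"
    by (simp add: linear_continuous_on linear_linear)
  then have [measurable]: "f \<in> borel_measurable borel"
    by (rule borel_measurable_continuous_onI)
  have inv: "orthogonal_transformation (inv f)"
    using assms by (rule orthogonal_transformation_inv)
  have F: "orthogonal_transformation F"
    unfolding orthogonal_transformation
  proof (intro conjI allI)
    have "linear h" "linear k"
      by (auto simp: h_def k_def vec_eq_iff forall_2 complex_eq_iff intro!: linearI)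
    then show "linear F"
      unfolding F_def using orthogonal_transformation_linear[OF inv] by (intro linear_compose)
    have "norm (k z) = norm z" "norm (h v) = norm v" for z v
      by (auto simp: h_def k_def norm_vec_def L2_set_def UNIV_2 cmod_def)
    then show "norm (F v) = norm v" for v
      using inv by (simp add: F_def orthogonal_transformation)
  qed
  have pre: "f -` box l u = inv f ` box l u"
    using orthogonal_transformation_bij[OF assms] by (simp add: bij_vimage_eq_inv_image)
  have "h -` (inv f ` box l u) = F ` (h -` box l u)"
  proof (intro equalityI subsetI)
    fix v assume "v \<in> h -` (inv f ` box l u)"
    then obtain z where "z \<in> box l u" "h v = inv f z"
      by auto
    then show "v \<in> F ` (h -` box l u)"
      using hk kh[of v] by (intro image_eqI[of _ _ "k z"]) (auto simp: F_def)
  qed (auto simp: F_def hk)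
  moreover have "h -` box l u = box (k l) (k u)"
    by (auto simp: h_def k_def box_def Basis_complex_def Basis_vec_def inner_axis forall_2)
  ultimately have eq: "h -` (f -` box l u) = F ` box (k l) (k u)"
    using pre by simp
  have "emeasure (distr lborel borel f) (box l u) = emeasure lborel (f -` box l u)"
    by (simp add: emeasure_distr)
  also have "\<dots> = emeasure (distr lborel borel h) (f -` box l u)"
    by (simp add: distr_lborel_vec_complex h_def)
  also have "\<dots> = emeasure lborel (h -` (f -` box l u))"
    using measurable_sets_borel[of f borel "box l u"] by (simp add: emeasure_distr)
  also have "\<dots> = emeasure lebesgue (F ` box (k l) (k u))"
    unfolding eq[symmetric]
    by (subst emeasure_completion) (use measurable_sets_borel[of "f \<circ> h" borel "box l u"] in \<open>simp_all add: vimage_comp\<close>)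
  also have "\<dots> = ennreal (measure lebesgue (box (k l) (k u)))"
  proof -
    have "F ` box (k l) (k u) \<in> lmeasurable"
      by (rule measurable_orthogonal_image[OF F]) simp
    then show ?thesis
      by (simp add: emeasure_eq_measure2 measure_orthogonal_image[OF F])
  qed
  also have "\<dots> = ennreal (\<Prod>b\<in>Basis. (u - l) \<bullet> b)"
    using le[of 1] le[of \<i>] by (simp add: k_def measure_lborel_box_eq Basis_complex_def Basis_vec_def
        inner_axis forall_2 UNIV_2 axis_eq_axis)
  finally show "emeasure (distr lborel borel f) (box l u) = ennreal (\<Prod>b\<in>Basis. (u - l) \<bullet> b)" .
qed simp

section \<open>Gaussian integrals over the line and the plane\<close>

lemma nn_integral_exp_minus_square:
  "(\<integral>\<^sup>+ x. ennreal (exp (- x\<^sup>2)) \<partial>lborel) = ennreal (sqrt pi)"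
proof -
  have "has_bochner_integral lborel (\<lambda>x::real. exp (- x\<^sup>2)) (2 * (sqrt pi / 2))"
    using has_bochner_integral_even_function[OF gaussian_moment_0] by simp
  then show ?thesis
    by (subst nn_integral_eq_integral) (auto simp: has_bochner_integral_iff)
qed

lemma has_bochner_integral_gaussian_complex:
  "has_bochner_integral lborel (\<lambda>z::complex. exp (- (norm z)\<^sup>2)) pi"
proof -
  have "(\<integral>\<^sup>+ z. ennreal (exp (- (norm (z::complex))\<^sup>2)) \<partial>lborel)
      = (\<integral>\<^sup>+ z. (\<Prod>b\<in>Basis. ennreal (exp (- ((z::complex) \<bullet> b)\<^sup>2))) \<partial>lborel)"
    by (intro nn_integral_cong)
      (simp add: Basis_complex_def cmod_power2 exp_add[symmetric] ennreal_mult[symmetric])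
  also have "\<dots> = (\<Prod>b\<in>(Basis::complex set). \<integral>\<^sup>+ x. ennreal (exp (- x\<^sup>2)) \<partial>lborel)"
    by (intro nn_integral_lborel_prod) auto
  also have "\<dots> = ennreal pi"
    by (simp add: nn_integral_exp_minus_square Basis_complex_def ennreal_mult[symmetric])
  finally show ?thesis
    by (intro has_bochner_integral_nn_integral) auto
qed

section \<open>Invariance of integrals under isometries\<close>

lemma
  fixes f :: "complex \<Rightarrow> complex" and g :: "complex \<Rightarrow> 'a::{banach, second_countable_topology}"
  assumes "orthogonal_transformation f" and [measurable]: "g \<in> borel_measurable borel"
  shows integrable_orthogonal_complex_iff:
      "integrable lborel (\<lambda>z. g (f z)) \<longleftrightarrow> integrable lborel g"
    and integral_orthogonal_complex: "(LINT z|lborel. g (f z)) = (LINT z|lborel. g z)"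
proof -
  have "continuous_on UNIV f"
    using assms(1) by (simp add: linear_continuous_on linear_linear orthogonal_transformation_linear)
  then have [measurable]: "f \<in> borel_measurable borel"
    by (rule borel_measurable_continuous_onI)
  show "integrable lborel (\<lambda>z. g (f z)) \<longleftrightarrow> integrable lborel g"
    by (subst (2) distr_lborel_orthogonal_complex[OF assms(1), symmetric])
      (simp add: integrable_distr_eq)
  show "(LINT z|lborel. g (f z)) = (LINT z|lborel. g z)"
    by (subst (2) distr_lborel_orthogonal_complex[OF assms(1), symmetric])
      (simp add: integral_distr)
qed

lemma
  fixes c :: complex and g :: "complex \<Rightarrow> 'a::{banach, second_countable_topology}"
  assumes [measurable]: "g \<in> borel_measurable borel"
  shows integrable_translation_complex_iff:
      "integrable lborel (\<lambda>z. g (c + z)) \<longleftrightarrow> integrable lborel g"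
    and integral_translation_complex: "(LINT z|lborel. g (c + z)) = (LINT z|lborel. g z)"
proof -
  show "integrable lborel (\<lambda>z. g (c + z)) \<longleftrightarrow> integrable lborel g"
    by (subst (2) lborel_distr_plus[of c, symmetric]) (simp add: integrable_distr_eq)
  show "(LINT z|lborel. g (c + z)) = (LINT z|lborel. g z)"
    by (subst (2) lborel_distr_plus[of c, symmetric]) (simp add: integral_distr)
qed

lemma orthogonal_transformation_rotation:
  fixes c :: complex
  assumes "norm c = 1"
  shows "orthogonal_transformation (\<lambda>z. c * z)"
  using assms by (auto simp: orthogonal_transformation norm_mult algebra_simps intro!: linearI)

lemma orthogonal_transformation_reflection:
  fixes c :: complex
  assumes "norm c = 1"
  shows "orthogonal_transformation (\<lambda>z. cnj (c * z))"
  using assms by (auto simp: orthogonal_transformation norm_mult algebra_simps complex_eq_iff intro!: linearI)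

section \<open>Mean values of entire functions\<close>

lemma entire_borel_measurable:
  fixes f :: "complex \<Rightarrow> complex"
  assumes "f holomorphic_on UNIV"
  shows "f \<in> borel_measurable borel"
  using assms by (intro borel_measurable_continuous_onI holomorphic_on_imp_continuous_on)

text \<open>Cauchy's formula at the centre of the unit circle, applied to u \<mapsto> F(u z);
  \<open>z = 0\<close> needs no separate case.\<close>

lemma has_integral_circle_mean:
  fixes F :: "complex \<Rightarrow> complex"
  assumes "F holomorphic_on UNIV"
  shows "((\<lambda>t. F (cis (2 * pi * t) * z)) has_integral F 0) {0..1}"
proof -
  have "(F \<circ> (\<lambda>u. u * z)) holomorphic_on cball 0 1"
    by (rule holomorphic_on_compose_gen[OF _ assms]) (auto intro!: holomorphic_intros)
  then have "((\<lambda>u. F (u * z) / (u - 0)) has_contour_integral (2 * of_real pi * \<i> * F (0 * z)))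
      (circlepath 0 1)"
    by (intro Cauchy_integral_circlepath_simple) (auto simp: o_def)
  then have "((\<lambda>t. F (circlepath 0 1 t * z) / circlepath 0 1 t
      * vector_derivative (circlepath 0 1) (at t within {0..1}))
      has_integral 2 * of_real pi * \<i> * F 0) {0..1}"
    by (simp add: has_contour_integral_def)
  then have "((\<lambda>t. 2 * of_real pi * \<i> * F (cis (2 * pi * t) * z))
      has_integral 2 * of_real pi * \<i> * F 0) {0..1}"
  proof (rule has_integral_eq[rotated])
    fix t :: real
    assume "t \<in> {0..1}"
    then have "vector_derivative (circlepath 0 1) (at t within {0..1})
        = 2 * of_real pi * \<i> * circlepath 0 1 t"
      using vector_derivative_circlepath01[of t 0 1] by (simp add: circlepath)
    moreover have "circlepath 0 1 t = cis (2 * pi * t)"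
      by (simp add: circlepath cis_conv_exp mult_ac)
    ultimately show "F (circlepath 0 1 t * z) / circlepath 0 1 t
        * vector_derivative (circlepath 0 1) (at t within {0..1})
      = 2 * of_real pi * \<i> * F (cis (2 * pi * t) * z)"
      by simp
  qed
  from has_integral_mult_right[OF this, of "1 / (2 * of_real pi * \<i>)"]
  show ?thesis
    by (simp add: field_simps)
qed

text \<open>Averaging over all rotations replaces polar coordinates.\<close>

lemma integral_entire_gaussian:
  fixes F :: "complex \<Rightarrow> complex"
  assumes holF: "F holomorphic_on UNIV"
    and int: "integrable lborel (\<lambda>z. F z * of_real (exp (- (norm z)\<^sup>2)))"
  shows "(LINT z|lborel. F z * of_real (exp (- (norm z)\<^sup>2))) = of_real pi * F 0"
proof -
  define G where "G = (\<lambda>z. F z * complex_of_real (exp (- (norm z)\<^sup>2)))"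
  \<comment> \<open>Integrated over z first, \<open>H\<close> gives the integral of \<open>G\<close>
    for every t in [0,1]; integrated over t first, it gives F(0) times the weight. Fubini equates
    the two.\<close>
  define H where "H = (\<lambda>(t::real, z). indicator {0..1} t *\<^sub>R G (cis (2 * pi * t) * z))"
  have [measurable]: "F \<in> borel_measurable borel"
    using holF by (rule entire_borel_measurable)
  have G [measurable]: "G \<in> borel_measurable borel"
    unfolding G_def by measurable
  have intG: "integrable lborel G"
    using int by (simp add: G_def)
  have rot: "orthogonal_transformation (\<lambda>z. cis (2 * pi * t) * z)" for t
    by (intro orthogonal_transformation_rotation) simp
  have intGr: "integrable lborel (\<lambda>z. G (cis (2 * pi * t) * z))" for t
    using intG integrable_orthogonal_complex_iff[OF rot G] by blast
  have [measurable]: "(\<lambda>t::real. cis (2 * pi * t)) \<in> borel_measurable borel"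
    by (intro borel_measurable_continuous_onI continuous_intros)
  have Hm: "H \<in> borel_measurable (lborel \<Otimes>\<^sub>M lborel)"
    unfolding H_def by measurable
  have norms: "(LINT z|lborel. norm (H (t, z)))
      = indicator {0..1} t *\<^sub>R (LINT z|lborel. norm (G z))" for t
    using integral_orthogonal_complex[OF rot, of "\<lambda>z. norm (G z)" t]
    by (simp add: H_def abs_mult)
  have "integrable (lborel \<Otimes>\<^sub>M lborel) H"
  proof (rule lborel_pair.Fubini_integrable[OF Hm])
    show "integrable lborel (\<lambda>t. LINT z|lborel. norm (H (t, z)))"
      unfolding norms by (intro integrable_scaleR_left integrable_real_indicator) auto
    show "AE t in lborel. integrable lborel (\<lambda>z. H (t, z))"
      by (simp add: H_def intGr)
  qed
  then have "(LINT z|lborel. LINT t|lborel. H (t, z)) = (LINT t|lborel. LINT z|lborel. H (t, z))"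
    by (intro lborel_pair.Fubini_integral) (simp add: case_prod_unfold)
  moreover have "(LINT z|lborel. H (t, z)) = indicator {0..1} t *\<^sub>R (LINT z|lborel. G z)" for t
    using integral_orthogonal_complex[OF rot G, of t] by (simp add: H_def)
  moreover have "(LINT t|lborel. H (t, z)) = of_real (exp (- (norm z)\<^sup>2)) * F 0" for z
  proof -
    have cont: "continuous_on {0..1} (\<lambda>t. F (cis (2 * pi * t) * z))"
      by (rule continuous_on_compose2[OF holomorphic_on_imp_continuous_on[OF holF]])
        (auto intro!: continuous_intros)
    have "H (t, z) = of_real (exp (- (norm z)\<^sup>2)) * (indicator {0..1} t *\<^sub>R F (cis (2 * pi * t) * z))" for t
      by (simp add: H_def G_def norm_mult)
    moreover have "(LINT t:{0..1}|lborel. F (cis (2 * pi * t) * z)) = F 0"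
    proof (subst set_borel_integral_eq_integral(2))
      show "set_integrable lborel {0..1} (\<lambda>t. F (cis (2 * pi * t) * z))"
        using borel_integrable_compact[OF _ cont] by (simp add: set_integrable_def)
      show "integral {0..1} (\<lambda>t. F (cis (2 * pi * t) * z)) = F 0"
        using has_integral_circle_mean[OF holF] by (rule integral_unique)
    qed
    ultimately show ?thesis
      by (simp only: set_lebesgue_integral_def integral_mult_right_zero)
  qed
  ultimately have "(LINT z|lborel. of_real (exp (- (norm (z::complex))\<^sup>2)) * F 0)
      = (LINT t|lborel. indicator {0..1::real} t *\<^sub>R (LINT z|lborel. G z))"
    by simp
  moreover have "(LINT z|lborel. complex_of_real (exp (- (norm (z::complex))\<^sup>2))) = of_real pi"
    using has_bochner_integral_gaussian_complex
    by (simp only: integral_complex_of_real has_bochner_integral_integral_eq)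
  ultimately show ?thesis
    by (simp add: G_def)
qed

section \<open>The Fock space and its reproducing kernel\<close>

definition fock_kernel :: "complex \<Rightarrow> complex \<Rightarrow> complex" where
  "fock_kernel w = (\<lambda>z. exp (z * cnj w))"

lemma fock_iff:
  "f \<in> fock \<longleftrightarrow> f holomorphic_on UNIV \<and>
     integrable lborel (\<lambda>z. (norm (f z))\<^sup>2 * exp (- (norm z)\<^sup>2))"
  by (simp add: fock_def)

lemma fock_holomorphic: "f \<in> fock \<Longrightarrow> f holomorphic_on UNIV"
  by (simp add: fock_def)

lemma fock_lincomb:
  assumes "f \<in> fock" "g \<in> fock"
  shows "(\<lambda>z. \<alpha> * f z + \<beta> * g z) \<in> fock"
  unfolding fock_iff
proof (intro conjI)
  have [measurable]: "f \<in> borel_measurable borel" "g \<in> borel_measurable borel"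
    using assms by (auto intro: entire_borel_measurable fock_holomorphic)
  show "(\<lambda>z. \<alpha> * f z + \<beta> * g z) holomorphic_on UNIV"
    using assms by (intro holomorphic_intros fock_holomorphic)
  show "integrable lborel (\<lambda>z. (norm (\<alpha> * f z + \<beta> * g z))\<^sup>2 * exp (- (norm z)\<^sup>2))"
  proof (rule Bochner_Integration.integrable_bound)
    show "integrable lborel (\<lambda>z. 2 * (norm \<alpha>)\<^sup>2 * ((norm (f z))\<^sup>2 * exp (- (norm z)\<^sup>2))
        + 2 * (norm \<beta>)\<^sup>2 * ((norm (g z))\<^sup>2 * exp (- (norm z)\<^sup>2)))"
      using assms by (intro Bochner_Integration.integrable_add integrable_mult_right) (auto simp: fock_iff)
    have "(norm (\<alpha> * f z + \<beta> * g z))\<^sup>2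
        \<le> 2 * (norm \<alpha>)\<^sup>2 * (norm (f z))\<^sup>2 + 2 * (norm \<beta>)\<^sup>2 * (norm (g z))\<^sup>2" for z
    proof -
      have "(norm (\<alpha> * f z + \<beta> * g z))\<^sup>2 \<le> (norm (\<alpha> * f z) + norm (\<beta> * g z))\<^sup>2"
        by (intro power_mono norm_triangle_ineq) simp
      also have "\<dots> \<le> 2 * (norm (\<alpha> * f z))\<^sup>2 + 2 * (norm (\<beta> * g z))\<^sup>2"
        using sum_squares_bound[of "norm (\<alpha> * f z)" "norm (\<beta> * g z)"] by (simp add: power2_sum)
      finally show ?thesis
        by (simp add: norm_mult power_mult_distrib)
    qed
    from mult_right_mono[OF this, of "exp (- (norm z)\<^sup>2)" for z]
    show "AE z in lborel. norm ((norm (\<alpha> * f z + \<beta> * g z))\<^sup>2 * exp (- (norm z)\<^sup>2))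
        \<le> norm (2 * (norm \<alpha>)\<^sup>2 * ((norm (f z))\<^sup>2 * exp (- (norm z)\<^sup>2))
        + 2 * (norm \<beta>)\<^sup>2 * ((norm (g z))\<^sup>2 * exp (- (norm z)\<^sup>2)))"
      by (intro AE_I2) (simp add: distrib_right mult.assoc)
  qed measurable
qed

lemma fock_inner_integrable:
  assumes "f \<in> fock" "g \<in> fock"
  shows "integrable lborel (\<lambda>z. f z * cnj (g z) * complex_of_real (exp (- (norm z)\<^sup>2)))"
proof (rule Bochner_Integration.integrable_bound)
  have [measurable]: "f \<in> borel_measurable borel" "g \<in> borel_measurable borel"
    using assms by (auto intro: entire_borel_measurable fock_holomorphic)
  have [measurable]: "cnj \<in> borel_measurable borel"
    by (intro borel_measurable_continuous_onI continuous_intros)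
  show "(\<lambda>z. f z * cnj (g z) * complex_of_real (exp (- (norm z)\<^sup>2))) \<in> borel_measurable lborel"
    by measurable
  show "integrable lborel (\<lambda>z. (norm (f z))\<^sup>2 * exp (- (norm z)\<^sup>2) + (norm (g z))\<^sup>2 * exp (- (norm z)\<^sup>2))"
    using assms by (intro Bochner_Integration.integrable_add) (auto simp: fock_iff)
  have "norm (f z) * norm (g z) \<le> (norm (f z))\<^sup>2 + (norm (g z))\<^sup>2" for z
    using sum_squares_bound[of "norm (f z)" "norm (g z)"] mult_nonneg_nonneg[of "norm (f z)" "norm (g z)"]
    unfolding mult.assoc by (simp del: mult_nonneg_nonneg)
  from mult_right_mono[OF this, of "exp (- (norm z)\<^sup>2)" for z]
  show "AE z in lborel. norm (f z * cnj (g z) * complex_of_real (exp (- (norm z)\<^sup>2)))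
      \<le> norm ((norm (f z))\<^sup>2 * exp (- (norm z)\<^sup>2) + (norm (g z))\<^sup>2 * exp (- (norm z)\<^sup>2))"
    by (intro AE_I2) (simp add: distrib_right norm_mult)
qed

lemma fock_inner_lincomb_left:
  assumes "f \<in> fock" "g \<in> fock" "h \<in> fock"
  shows "fock_inner (\<lambda>z. \<alpha> * f z + \<beta> * g z) h = \<alpha> * fock_inner f h + \<beta> * fock_inner g h"
proof -
  have "(LINT z|lborel. (\<alpha> * f z + \<beta> * g z) * cnj (h z) * complex_of_real (exp (- (norm z)\<^sup>2)))
     = (LINT z|lborel. \<alpha> * (f z * cnj (h z) * complex_of_real (exp (- (norm z)\<^sup>2)))
         + \<beta> * (g z * cnj (h z) * complex_of_real (exp (- (norm z)\<^sup>2))))"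
    by (simp only: algebra_simps)
  also have "\<dots> = \<alpha> * (LINT z|lborel. f z * cnj (h z) * complex_of_real (exp (- (norm z)\<^sup>2)))
         + \<beta> * (LINT z|lborel. g z * cnj (h z) * complex_of_real (exp (- (norm z)\<^sup>2)))"
    using assms
    by (subst Bochner_Integration.integral_add)
      (auto intro!: integrable_mult_right fock_inner_integrable simp del: of_real_exp)
  finally show ?thesis
    by (simp add: fock_inner_def algebra_simps)
qed

lemma fock_inner_commute: "fock_inner g f = cnj (fock_inner f g)"
proof -
  have "cnj (LINT z|lborel. f z * cnj (g z) * complex_of_real (exp (- (norm z)\<^sup>2)))
      = (LINT z|lborel. g z * cnj (f z) * complex_of_real (exp (- (norm z)\<^sup>2)))"
    by (subst Bochner_Integration.integral_cnj[symmetric]) (simp add: mult_ac)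
  then show ?thesis
    by (simp add: fock_inner_def)
qed

text \<open>The inner product of f with itself is real, so \<open>Re\<close> in the norm discards
  nothing.\<close>

lemma fock_inner_self:
  "fock_inner f f = of_real ((1 / pi) * (LINT z|lborel. (norm (f z))\<^sup>2 * exp (- (norm z)\<^sup>2)))"
proof -
  have "f z * cnj (f z) * complex_of_real (exp (- (norm z)\<^sup>2))
      = of_real ((norm (f z))\<^sup>2 * exp (- (norm z)\<^sup>2))" for z
    by (simp only: complex_norm_square of_real_mult)
  then show ?thesis
    unfolding fock_inner_def by (simp only: integral_complex_of_real of_real_mult[of "1 / pi"])
qed

lemma Re_fock_inner_self_nonneg: "0 \<le> Re (fock_inner f f)"
  by (simp add: fock_inner_self integral_nonneg)

lemma fock_norm_square: "(fock_norm f)\<^sup>2 = Re (fock_inner f f)"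
  by (simp add: fock_norm_def Re_fock_inner_self_nonneg)

lemma fock_norm_nonneg: "0 \<le> fock_norm f"
  by (simp add: fock_norm_def Re_fock_inner_self_nonneg)

lemma norm_add_square_complex:
  "(norm (w + z))\<^sup>2 = (norm w)\<^sup>2 + (norm z)\<^sup>2 + 2 * Re (w * cnj z)" for w z :: complex
  by (simp add: cmod_power2) (simp add: power2_eq_square algebra_simps)

text \<open>Completing the square turns the weighted squared modulus into exp(|w|^2) times a
  Gaussian centred at w.\<close>

lemma fock_kernel_in_fock [simp]: "fock_kernel w \<in> fock"
  unfolding fock_iff
proof (intro conjI)
  show "fock_kernel w holomorphic_on UNIV"
    unfolding fock_kernel_def by (intro holomorphic_intros)
  have "integrable lborel (\<lambda>z. exp (- (norm (-w + z))\<^sup>2))"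
    using has_bochner_integral_gaussian_complex
      integrable_translation_complex_iff[of "\<lambda>z. exp (- (norm z)\<^sup>2)" "-w"]
    by (auto simp: has_bochner_integral_iff)
  then have "integrable lborel (\<lambda>z. exp ((norm w)\<^sup>2) * exp (- (norm (-w + z))\<^sup>2))"
    by (rule integrable_mult_right)
  also have "(\<lambda>z. exp ((norm w)\<^sup>2) * exp (- (norm (-w + z))\<^sup>2))
      = (\<lambda>z. (norm (fock_kernel w z))\<^sup>2 * exp (- (norm z)\<^sup>2))"
    unfolding norm_add_square_complex fock_kernel_def
    by (auto simp: fun_eq_iff exp_add[symmetric] exp_double[symmetric])
  finally show "integrable lborel (\<lambda>z. (norm (fock_kernel w z))\<^sup>2 * exp (- (norm z)\<^sup>2))" .
qed

text \<open>Translating by w recentres the Gaussian and leaves an entire factor whose value at 0 is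
  f(w); the Gaussian mean value formula then evaluates the integral.\<close>

lemma fock_inner_kernel:
  assumes "f \<in> fock"
  shows "fock_inner f (fock_kernel w) = f w"
proof -
  \<comment> \<open>The factor that remains after z = w + u: the exponents of the conjugated kernel
    and the weight add up to - u cnj w - |u|^2.\<close>
  define F where "F = (\<lambda>u. f (w + u) * exp (- (u * cnj w)))"
  define G where "G = (\<lambda>z. f z * cnj (fock_kernel w z) * complex_of_real (exp (- (norm z)\<^sup>2)))"
  have "f holomorphic_on UNIV"
    using assms by (rule fock_holomorphic)
  then have "(f \<circ> (\<lambda>u. w + u)) holomorphic_on UNIV"
    by (intro holomorphic_on_compose_gen[of _ _ f UNIV] holomorphic_intros) auto
  then have F: "F holomorphic_on UNIV"
    unfolding F_def by (auto intro!: holomorphic_intros simp: o_def)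
  have intG: "integrable lborel G"
    unfolding G_def using assms by (intro fock_inner_integrable) auto
  then have Gm: "G \<in> borel_measurable borel"
    by auto
  have GF: "G (w + u) = F u * of_real (exp (- (norm u)\<^sup>2))" for u
  proof -
    have "cnj ((w + u) * cnj w) + - of_real ((norm (w + u))\<^sup>2)
        = - (u * cnj w) + - of_real ((norm u)\<^sup>2)"
      unfolding complex_norm_square by (simp add: algebra_simps)
    then have "exp (cnj ((w + u) * cnj w)) * exp (- of_real ((norm (w + u))\<^sup>2))
        = exp (- (u * cnj w)) * exp (- of_real ((norm u)\<^sup>2))"
      by (simp only: exp_add[symmetric])
    then show ?thesis
      unfolding G_def F_def fock_kernel_def
      by (simp only: exp_of_real[symmetric] of_real_minus exp_cnj mult.assoc)
  qed
  have "(LINT z|lborel. G z) = of_real pi * F 0"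
    using integral_entire_gaussian[OF F] integrable_translation_complex_iff[OF Gm, of w]
      integral_translation_complex[OF Gm, of w] intG
    by (simp only: GF)
  then show ?thesis
    by (simp add: fock_inner_def G_def F_def)
qed

lemma fock_norm_kernel: "fock_norm (fock_kernel w) = exp ((norm w)\<^sup>2 / 2)"
proof -
  have "(fock_norm (fock_kernel w))\<^sup>2 = Re (exp (of_real ((norm w)\<^sup>2)))"
    unfolding fock_norm_square
    by (subst fock_inner_kernel[OF fock_kernel_in_fock]) (simp only: fock_kernel_def complex_norm_square)
  also have "\<dots> = (exp ((norm w)\<^sup>2 / 2))\<^sup>2"
    by (simp only: exp_of_real Re_complex_of_real exp_double[symmetric]) simp
  finally show ?thesis
    by (rule power2_eq_imp_eq) (auto simp: fock_norm_nonneg)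
qed

lemma fock_norm_cmult: "fock_norm (\<lambda>z. c * f z) = norm c * fock_norm f"
proof -
  have "(LINT z|lborel. (norm (c * f z))\<^sup>2 * exp (- (norm z)\<^sup>2))
      = (norm c)\<^sup>2 * (LINT z|lborel. (norm (f z))\<^sup>2 * exp (- (norm z)\<^sup>2))"
    by (simp add: norm_mult power_mult_distrib mult.assoc)
  then show ?thesis
    unfolding fock_norm_def fock_inner_self
    by (simp add: real_sqrt_mult real_sqrt_divide)
qed

text \<open>This is Cauchy-Schwarz against the kernel at z: subtract from f its projection onto the
  kernel and use that the remainder has nonnegative square norm.\<close>

lemma fock_pointwise_bound:
  assumes f: "f \<in> fock"
  shows "norm (f z) \<le> fock_norm f * exp ((norm z)\<^sup>2 / 2)"
proof -
  \<comment> \<open>Chosen so that g(z) = 0, since the kernel at z takes the value exp(|z|^2) there;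
    by the reproducing property g is then orthogonal to the kernel.\<close>
  define c where "c = f z * exp (- of_real ((norm z)\<^sup>2))"
  define g where "g = (\<lambda>u. 1 * f u + (- c) * fock_kernel z u)"
  have g: "g \<in> fock"
    unfolding g_def using f by (intro fock_lincomb) auto
  have "fock_kernel z z = exp (of_real ((norm z)\<^sup>2))"
    by (simp only: fock_kernel_def complex_norm_square)
  then have gz: "g z = 0"
    by (simp add: g_def c_def mult.assoc flip: exp_add)
  have Kf: "fock_inner (fock_kernel z) f = cnj (f z)" and Kg: "fock_inner (fock_kernel z) g = 0"
    using fock_inner_kernel[OF f, of z] fock_inner_kernel[OF g, of z] gz
      fock_inner_commute[of "fock_kernel z" f] fock_inner_commute[of "fock_kernel z" g] by simp_all
  have "fock_inner g g = fock_inner f g"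
    using fock_inner_lincomb_left[OF f fock_kernel_in_fock g, of 1 "- c" z] Kg
    by (simp add: g_def)
  also have "\<dots> = cnj (fock_inner g f)"
    by (rule fock_inner_commute)
  also have "fock_inner g f = fock_inner f f - c * cnj (f z)"
    using fock_inner_lincomb_left[OF f fock_kernel_in_fock f, of 1 "- c" z] Kf
    by (simp add: g_def)
  finally have "0 \<le> Re (fock_inner f f) - Re (c * cnj (f z))"
    using Re_fock_inner_self_nonneg[of g] by simp
  moreover have "c * cnj (f z) = of_real ((norm (f z))\<^sup>2 * exp (- (norm z)\<^sup>2))"
    unfolding c_def of_real_mult by (simp only: complex_norm_square[of "f z"] exp_of_real[symmetric] of_real_minus mult_ac)
  ultimately have "(norm (f z))\<^sup>2 * exp (- (norm z)\<^sup>2) \<le> (fock_norm f)\<^sup>2"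
    by (simp add: fock_norm_square)
  then have "(norm (f z))\<^sup>2 \<le> (fock_norm f)\<^sup>2 * exp ((norm z)\<^sup>2)"
    by (simp add: exp_minus field_simps)
  also have "\<dots> = (fock_norm f * exp ((norm z)\<^sup>2 / 2))\<^sup>2"
    by (simp add: power_mult_distrib exp_double[symmetric])
  finally show ?thesis
    by (rule power2_le_imp_le) (simp add: fock_norm_nonneg)
qed

section \<open>Rigidity of the symbols\<close>

text \<open>The quotient g / (2M - g), rescaled to the unit disc, maps the disc into itself and
  fixes 0, so the Schwarz lemma applies.\<close>

lemma Borel_Caratheodory:
  fixes g :: "complex \<Rightarrow> complex"
  assumes hol: "g holomorphic_on ball 0 R" and g0: "g 0 = 0"
    and Re: "\<And>z. norm z < R \<Longrightarrow> Re (g z) < M" and z: "norm z < R"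
  shows "norm (g z) * (R - norm z) \<le> 2 * M * norm z"
proof -
  have R: "0 < R"
    using z norm_ge_zero[of z] by linarith
  have M: "0 < M"
    using Re[of 0] R g0 by simp
  \<comment> \<open>Geometrically, Re g < M says that g is closer to 0 than to its mirror point
    2M.\<close>
  have lt: "norm (g u) < norm (2 * of_real M - g u)" if "norm u < R" for u
  proof -
    have "(norm (2 * of_real M - g u))\<^sup>2 = (norm (g u))\<^sup>2 + 4 * M * (M - Re (g u))"
      by (simp add: cmod_power2) (simp add: power2_eq_square algebra_simps)
    then have "(norm (g u))\<^sup>2 < (norm (2 * of_real M - g u))\<^sup>2"
      using Re[OF that] M by simp
    then show ?thesis
      by (rule power2_less_imp_less) simp
  qed
  define h where "h = (\<lambda>u. g (of_real R * u) / (2 * of_real M - g (of_real R * u)))"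
  have sc: "norm (of_real R * u) < R" if "norm u < 1" for u :: complex
    using that R by (simp add: norm_mult)
  have "(g \<circ> (\<lambda>u. of_real R * u)) holomorphic_on ball 0 1"
    by (rule holomorphic_on_compose_gen[OF _ hol]) (use sc in \<open>auto intro!: holomorphic_intros\<close>)
  moreover have "2 * of_real M - g (of_real R * u) \<noteq> 0" if "norm u < 1" for u
    using lt[OF sc[OF that]] by (metis norm_not_less_zero norm_zero)
  ultimately have "h holomorphic_on ball 0 1"
    unfolding h_def by (intro holomorphic_intros) (auto simp: o_def)
  moreover have "norm (h u) < 1" if "norm u < 1" for u
  proof -
    have "0 < norm (2 * of_real M - g (of_real R * u))"
      using lt[OF sc[OF that]] norm_ge_zero le_less_trans by blast
    then show ?thesis
      using lt[OF sc[OF that]] by (simp add: h_def norm_divide)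
  qed
  moreover have "norm (z / of_real R) < 1"
    using z R by (simp add: norm_divide)
  ultimately have "norm (h (z / of_real R)) \<le> norm (z / of_real R)"
    using g0 by (intro Schwarz_Lemma) (auto simp: h_def)
  then have "norm (g z) / norm (2 * of_real M - g z) \<le> norm z / R"
    using R by (simp add: h_def norm_divide)
  moreover have "0 < norm (2 * of_real M - g z)"
    using lt[OF z] norm_ge_zero le_less_trans by blast
  ultimately have "norm (g z) * R \<le> norm z * norm (2 * of_real M - g z)"
    using R by (simp add: field_simps)
  also have "\<dots> \<le> norm z * (2 * M + norm (g z))"
    using norm_triangle_ineq4[of "2 * of_real M" "g z"] M by (intro mult_left_mono) auto
  finally show ?thesis
    by (simp add: algebra_simps)
qed

text \<open>Borel-Caratheodory turns the one-sided bound on the real part into a bound of order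
  |z|^n on |g|, and Liouville's theorem for polynomial growth finishes.\<close>

lemma entire_Re_le_imp_polynomial:
  fixes g :: "complex \<Rightarrow> complex"
  assumes hol: "g holomorphic_on UNIV" and Re: "\<And>z. Re (g z) \<le> B * norm z ^ n + M"
  shows "g \<xi> = (\<Sum>k\<le>n. (deriv ^^ k) g 0 / fact k * \<xi> ^ k)"
proof (rule Liouville_polynomial[OF hol])
  fix z :: complex
  assume z: "1 \<le> norm z"
  define r where "r = norm z"
  \<comment> \<open>The summand 1 makes the bound strict, as Borel-Caratheodory demands.\<close>
  define M' where "M' = \<bar>M - Re (g 0)\<bar> + 1"
  have r: "1 \<le> r" "1 \<le> r ^ n"
    using z by (auto simp: r_def)
  \<comment> \<open>On the disc of radius 2|z| the factor R - |z| equals |z| and cancels the one on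
    the right.\<close>
  have "norm (g z - g 0) * (2 * r - norm z) \<le> 2 * (\<bar>B\<bar> * (2 * r) ^ n + M') * norm z"
  proof (rule Borel_Caratheodory)
    show "(\<lambda>z. g z - g 0) holomorphic_on ball 0 (2 * r)"
      using hol by (auto intro!: holomorphic_intros intro: holomorphic_on_subset)
    fix u :: complex
    assume "norm u < 2 * r"
    then have "\<bar>B\<bar> * norm u ^ n \<le> \<bar>B\<bar> * (2 * r) ^ n"
      by (intro mult_left_mono power_mono) auto
    moreover have "B * norm u ^ n \<le> \<bar>B\<bar> * norm u ^ n"
      by (intro mult_right_mono) auto
    ultimately show "Re (g u - g 0) < \<bar>B\<bar> * (2 * r) ^ n + M'"
      using Re[of u] by (simp add: M'_def)
  qed (use r in \<open>auto simp: r_def\<close>)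
  then have "norm (g z - g 0) * r \<le> 2 * (\<bar>B\<bar> * (2 * r) ^ n + M') * r"
    by (simp add: r_def)
  then have "norm (g z - g 0) \<le> 2 * (\<bar>B\<bar> * (2 * r) ^ n + M')"
    by (rule mult_right_le_imp_le) (use r in simp)
  also have "\<dots> \<le> 2 * (\<bar>B\<bar> * 2 ^ n + M') * r ^ n"
    using r mult_left_mono[OF r(2), of M'] by (simp add: M'_def power_mult_distrib algebra_simps)
  finally have "norm (g z - g 0) \<le> 2 * (\<bar>B\<bar> * 2 ^ n + M') * r ^ n" .
  moreover have "norm (g z) \<le> norm (g z - g 0) + norm (g 0)"
    using norm_triangle_sub by (metis add.commute)
  moreover have "norm (g 0) \<le> norm (g 0) * r ^ n"
    using mult_left_mono[OF r(2), of "norm (g 0)"] by simp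
  ultimately show "norm (g z) \<le> (2 * (\<bar>B\<bar> * 2 ^ n + M') + norm (g 0)) * norm z ^ n"
    unfolding r_def by (simp add: distrib_right)
qed

lemma entire_Re_le_quadratic:
  fixes g :: "complex \<Rightarrow> complex"
  assumes "g holomorphic_on UNIV" and "\<And>z. Re (g z) \<le> M + (norm z)\<^sup>2 / 2"
  obtains a b c where "\<And>z. g z = a + b * z + c * z\<^sup>2"
proof -
  define c where "c k = (deriv ^^ k) g 0 / fact k" for k
  have "g z = (\<Sum>k\<le>2. c k * z ^ k)" for z
    unfolding c_def using assms
    by (intro entire_Re_le_imp_polynomial[of g "1/2" 2 M]) (auto simp: add.commute)
  also have "\<And>z. (\<Sum>k\<le>2. c k * z ^ k) = c 0 + c 1 * z + c 2 * z\<^sup>2"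
    by (simp add: numeral_2_eq_2)
  finally show thesis
    by (rule that)
qed

section \<open>Coefficients forced by real inequalities\<close>

lemma quadratic_nonpos_imp_lead_nonpos:
  fixes p q r :: real
  assumes "\<And>t. p * t\<^sup>2 + q * t + r \<le> 0"
  shows "p \<le> 0"
proof (rule ccontr)
  assume "\<not> p \<le> 0"
  then have p: "0 < p"
    by simp
  \<comment> \<open>With this t \<ge> 1 one has p t = p + |q| + |r|, so p t^2 outweighs both lower
    terms.\<close>
  define t where "t = 1 + (\<bar>q\<bar> + \<bar>r\<bar>) / p"
  have t: "1 \<le> t" "p * t = p + \<bar>q\<bar> + \<bar>r\<bar>"
    using p by (auto simp: t_def field_simps)
  have "p * t\<^sup>2 = (p + \<bar>q\<bar> + \<bar>r\<bar>) * t"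
    using t(2) by (simp add: power2_eq_square)
  moreover have "0 < p * t" "- \<bar>q\<bar> * t \<le> q * t" "\<bar>r\<bar> \<le> \<bar>r\<bar> * t"
    using t p mult_left_mono[OF t(1), of "\<bar>r\<bar>"] mult_right_mono[of "- \<bar>q\<bar>" q t] by auto
  ultimately show False
    using assms[of t] by (simp add: algebra_simps)
qed

lemma linear_nonpos_imp_slope_zero:
  fixes p r :: real
  assumes "\<And>s. p * s + r \<le> 0"
  shows "p = 0"
proof (rule ccontr)
  assume "p \<noteq> 0"
  then show False
    using assms[of "(\<bar>r\<bar> + 1) / p"] by simp
qed

text \<open>Along w = s cnj \<kappa> the real part is s |\<kappa>|^2, which is bounded above for all
  real s only if \<kappa> = 0.\<close>

lemma complex_eq_zero_if_Re_mult_bounded: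
  fixes \<kappa> :: complex
  assumes "\<And>w. Re (\<kappa> * w) \<le> M"
  shows "\<kappa> = 0"
proof -
  have "(norm \<kappa>)\<^sup>2 * s + (- M) \<le> 0" for s :: real
  proof -
    have "\<kappa> * (of_real s * cnj \<kappa>) = of_real ((norm \<kappa>)\<^sup>2 * s)"
      by (simp only: complex_norm_square of_real_mult mult_ac)
    then show ?thesis
      using assms[of "of_real s * cnj \<kappa>"] by (simp del: of_real_mult)
  qed
  then have "(norm \<kappa>)\<^sup>2 = 0"
    by (rule linear_nonpos_imp_slope_zero)
  then show ?thesis
    by simp
qed

text \<open>At z = cnj A w the terms in A cancel, leaving \<gamma> = 0 or A = 1 or A = -1. In the
  last two cases the shift z = A (w + 1) leaves an inequality linear in w.\<close>

lemma quadratic_coeff_zero: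
  fixes A \<gamma> :: complex
  assumes Q: "\<And>z w. Re (\<gamma> * z\<^sup>2) + Re (A * z * cnj w) \<le> Re (\<gamma> * w\<^sup>2) + (norm (A * w))\<^sup>2 / 2 + (norm z)\<^sup>2 / 2"
  shows "\<gamma> = 0"
proof -
  define \<kappa> where "\<kappa> = \<gamma> * ((cnj A)\<^sup>2 - 1)"
  have "Re (\<kappa> * u) \<le> 0" for u
  proof -
    \<comment> \<open>Every complex number is a square, so a bound in w^2 is a bound in an arbitrary
      u.\<close>
    define w where "w = csqrt u"
    have "A * (cnj A * w) * cnj w = of_real ((norm (A * w))\<^sup>2)"
      unfolding complex_norm_square by simp
    moreover have "norm (cnj A * w) = norm (A * w)"
      by (simp add: norm_mult)
    moreover have "u = w\<^sup>2"
      by (simp add: w_def)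
    ultimately show ?thesis
      using Q[of "cnj A * w" w] by (simp add: \<kappa>_def power_mult_distrib algebra_simps)
  qed
  then have "\<kappa> = 0"
    by (rule complex_eq_zero_if_Re_mult_bounded)
  then consider "\<gamma> = 0" | "(cnj A)\<^sup>2 = 1"
    by (auto simp: \<kappa>_def)
  then show ?thesis
  proof cases
    case 2
    then have A: "A = 1 \<or> A = - 1"
      by (metis complex_cnj_cnj complex_cnj_minus complex_cnj_one power2_eq_1_iff)
    have "Re (\<gamma> * w) \<le> (1 / 2 - Re \<gamma>) / 2" for w
    proof -
      have "A * (A * (w + 1)) * cnj w = of_real ((norm w)\<^sup>2) + cnj w"
        unfolding complex_norm_square using A by (auto simp: algebra_simps)
      moreover have "norm (A * w) = norm w" "norm (A * (w + 1)) = norm (w + 1)"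
        "(A * (w + 1))\<^sup>2 = w\<^sup>2 + 2 * w + 1"
        using A by (auto simp: norm_mult power2_sum power_mult_distrib)
      moreover have "(norm (w + 1))\<^sup>2 = (norm w)\<^sup>2 + 1 + 2 * Re w"
        using norm_add_square_complex[of w 1] by simp
      moreover have "Re (\<gamma> * (w\<^sup>2 + 2 * w + 1)) = Re (\<gamma> * w\<^sup>2) + 2 * Re (\<gamma> * w) + Re \<gamma>"
        by (simp add: algebra_simps)
      ultimately have "2 * Re (\<gamma> * w) + Re \<gamma> \<le> 1 / 2"
        using Q[of "A * (w + 1)" w] by (simp add: add_divide_distrib del: times_complex.sel)
      then show ?thesis
        by (simp del: times_complex.sel)
    qed
    then show ?thesis
      by (rule complex_eq_zero_if_Re_mult_bounded)
  qed
qed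

text \<open>The hypothesis \<open>le\<close> is the pointwise bound for the images of the kernels
  under a normal operator. With a logarithm of \<psi> it becomes an inequality between real parts,
  which is tested on suitable pairs (z, w).\<close>

lemma entire_symbols_affine_exp:
  fixes \<psi> \<phi> :: "complex \<Rightarrow> complex"
  assumes hol\<psi>: "\<psi> holomorphic_on UNIV" and hol\<phi>: "\<phi> holomorphic_on UNIV"
    and nz: "\<exists>z. \<psi> z \<noteq> 0"
    and le: "\<And>z w. norm (\<psi> z) * exp (Re (\<phi> z * cnj w))
        \<le> norm (\<psi> w) * exp ((norm (\<phi> w))\<^sup>2 / 2) * exp ((norm z)\<^sup>2 / 2)"
  obtains A B C D where "\<And>z. \<phi> z = A * z + B" "\<And>z. \<psi> z = C * exp (D * z)" "C \<noteq> 0"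
    "D * (1 - cnj A) = cnj B * (1 - A)"
proof -
  \<comment> \<open>A zero at w would make the right side of \<open>le\<close> vanish for every
    z.\<close>
  have nz': "\<psi> w \<noteq> 0" for w
  proof
    assume "\<psi> w = 0"
    then have "\<psi> z = 0" for z
      using le[of z w] by (simp add: mult_le_0_iff)
    with nz show False
      by blast
  qed
  obtain g where holg: "g holomorphic_on UNIV" and g: "\<And>z. exp (g z) = \<psi> z"
    using holomorphic_logarithm_exists[OF convex_UNIV open_UNIV hol\<psi> _ UNIV_I] nz' by auto
  have ineq: "Re (g z) + Re (\<phi> z * cnj w) \<le> Re (g w) + (norm (\<phi> w))\<^sup>2 / 2 + (norm z)\<^sup>2 / 2" for z w
    using le[of z w] by (simp add: g[symmetric] exp_add[symmetric] del: times_complex.sel)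
  \<comment> \<open>The choice w = 0 bounds Re g alone and w = 1 bounds Re (g + \<phi>), so \<phi>
    is a difference of two quadratics.\<close>
  obtain g0 D \<gamma> where gpoly: "\<And>z. g z = g0 + D * z + \<gamma> * z\<^sup>2"
    using entire_Re_le_quadratic[OF holg, of "Re (g 0) + (norm (\<phi> 0))\<^sup>2 / 2"] ineq[of _ 0] by auto
  have "(\<lambda>z. g z + \<phi> z) holomorphic_on UNIV"
    using holg hol\<phi> by (intro holomorphic_intros)
  then obtain h0 h1 h2 where hpoly: "\<And>z. g z + \<phi> z = h0 + h1 * z + h2 * z\<^sup>2"
    using entire_Re_le_quadratic[of "\<lambda>z. g z + \<phi> z" "Re (g 1) + (norm (\<phi> 1))\<^sup>2 / 2"] ineq[of _ 1]
    by auto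
  have "\<phi> z = (h0 - g0) + (h1 - D) * z + (h2 - \<gamma>) * z\<^sup>2" for z
    using hpoly[of z] unfolding gpoly by (simp add: algebra_simps)
  then obtain A B \<alpha> where \<phi>poly: "\<And>z. \<phi> z = B + A * z + \<alpha> * z\<^sup>2"
    by blast
  have "\<alpha> = 0"
  proof (rule complex_eq_zero_if_Re_mult_bounded)
    fix w
    \<comment> \<open>For fixed w and real z = t the bound is a quadratic in t; the second argument
      is \<open>cnj w\<close> so that \<alpha> is multiplied by w itself.\<close>
    have "(Re \<gamma> + Re (\<alpha> * w) - 1 / 2) * t\<^sup>2 + (Re D + Re (A * w)) * t
        + (Re g0 + Re (B * w) - Re (g (cnj w)) - (norm (\<phi> (cnj w)))\<^sup>2 / 2) \<le> 0" for t
      using ineq[of "of_real t" "cnj w"]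
      by (simp add: gpoly[of "of_real t"] \<phi>poly[of "of_real t"] algebra_simps power2_eq_square)
    then have "Re \<gamma> + Re (\<alpha> * w) - 1 / 2 \<le> 0"
      by (rule quadratic_nonpos_imp_lead_nonpos)
    then show "Re (\<alpha> * w) \<le> 1 / 2 - Re \<gamma>"
      by simp
  qed
  then have \<phi>: "\<phi> z = A * z + B" for z
    by (simp add: \<phi>poly)
  have "\<gamma> = 0"
  proof (rule quadratic_coeff_zero[of _ A])
    fix z w
    \<comment> \<open>Scaling z and w together by t and comparing coefficients of t^2 isolates the
      homogeneous part of the bound.\<close>
    have "(Re (\<gamma> * z\<^sup>2) + Re (A * z * cnj w) - Re (\<gamma> * w\<^sup>2) - (norm (A * w))\<^sup>2 / 2 - (norm z)\<^sup>2 / 2) * t\<^sup>2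
        + (Re (D * z) + Re (B * cnj w) - Re (D * w) - Re (A * w * cnj B)) * t + (- (norm B)\<^sup>2 / 2) \<le> 0" for t
    proof -
      have "(norm (\<phi> (of_real t * w)))\<^sup>2
          = t\<^sup>2 * (norm (A * w))\<^sup>2 + (norm B)\<^sup>2 + 2 * t * Re (A * w * cnj B)"
        unfolding \<phi> norm_add_square_complex by (simp add: norm_mult power_mult_distrib algebra_simps)
      moreover have "Re (g (of_real t * u)) = Re g0 + t * Re (D * u) + t\<^sup>2 * Re (\<gamma> * u\<^sup>2)" for u
        by (simp add: gpoly power2_eq_square algebra_simps)
      moreover have "Re (\<phi> (of_real t * z) * cnj (of_real t * w))
          = t\<^sup>2 * Re (A * z * cnj w) + t * Re (B * cnj w)"
        by (simp add: \<phi> power2_eq_square algebra_simps)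
      moreover have "(norm (of_real t * z))\<^sup>2 = t\<^sup>2 * (norm z)\<^sup>2"
        by (simp add: norm_mult power_mult_distrib)
      ultimately show ?thesis
        using ineq[of "of_real t * z" "of_real t * w"]
        by (simp add: algebra_simps add_divide_distrib del: times_complex.sel complex_cnj_mult)
    qed
    then show "Re (\<gamma> * z\<^sup>2) + Re (A * z * cnj w)
        \<le> Re (\<gamma> * w\<^sup>2) + (norm (A * w))\<^sup>2 / 2 + (norm z)\<^sup>2 / 2"
      using quadratic_nonpos_imp_lead_nonpos by fastforce
  qed
  then have gD: "g z = g0 + D * z" for z
    by (simp add: gpoly)
  have "D * cnj A + cnj B - D - A * cnj B = 0"
  proof (rule complex_eq_zero_if_Re_mult_bounded)
    fix w
    \<comment> \<open>At z = cnj A w the quadratic terms cancel again, so an expression linear in w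
      is bounded by |B|^2 / 2.\<close>
    have "(A * (cnj A * w) + B) * cnj w = of_real ((norm (A * w))\<^sup>2) + B * cnj w"
      unfolding complex_norm_square by (simp add: algebra_simps)
    moreover have "norm (cnj A * w) = norm (A * w)"
      by (simp add: norm_mult)
    moreover have "(norm (A * w + B))\<^sup>2 = (norm (A * w))\<^sup>2 + (norm B)\<^sup>2 + 2 * Re (A * w * cnj B)"
      by (rule norm_add_square_complex)
    moreover have "Re (B * cnj w) = Re (cnj B * w)"
      by simp
    ultimately show "Re ((D * cnj A + cnj B - D - A * cnj B) * w) \<le> (norm B)\<^sup>2 / 2"
      using ineq[of "cnj A * w" w] by (simp add: gD \<phi> algebra_simps)
  qed
  then have "D * (1 - cnj A) = cnj B * (1 - A)"
    by (simp add: algebra_simps)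
  moreover have "\<psi> z = exp g0 * exp (D * z)" for z
    by (simp add: g[symmetric] gD exp_add)
  ultimately show thesis
    using \<phi> that[of A B "exp g0" D] by auto
qed

section \<open>Normal weighted composition operators\<close>

lemma fock_inner_cmult_right: "fock_inner f (\<lambda>z. c * g z) = cnj c * fock_inner f g"
proof -
  have "f z * cnj (c * g z) * complex_of_real (exp (- (norm z)\<^sup>2))
      = cnj c * (f z * cnj (g z) * complex_of_real (exp (- (norm z)\<^sup>2)))" for z
    by simp
  then show ?thesis
    by (simp only: fock_inner_def integral_mult_right_zero mult.left_commute)
qed

lemma fock_inner_kernel_left: "f \<in> fock \<Longrightarrow> fock_inner (fock_kernel w) f = cnj (f w)"
  using fock_inner_commute[of "fock_kernel w" f] by (simp add: fock_inner_kernel)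

lemma fock_cmult:
  assumes "f \<in> fock"
  shows "(\<lambda>z. c * f z) \<in> fock"
  using fock_lincomb[OF assms assms, of c 0] by simp

text \<open>Once all kernels lie in the domain, testing against them determines the representing
  vector pointwise, which justifies the \<open>THE\<close> in the adjoint.\<close>

lemma adjoint_op_app_eqI:
  assumes ker: "\<And>w. fock_kernel w \<in> op_dom T"
    and h: "h \<in> fock" "\<And>f. f \<in> op_dom T \<Longrightarrow> fock_inner (op_app T f) g = fock_inner f h"
  shows "op_app (adjoint_op T) g = h"
proof -
  have "(THE h. h \<in> fock \<and> (\<forall>f\<in>op_dom T. fock_inner (op_app T f) g = fock_inner f h)) = h"
  proof (rule the_equality)
    fix k
    assume k: "k \<in> fock \<and> (\<forall>f\<in>op_dom T. fock_inner (op_app T f) g = fock_inner f k)"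
    have "cnj (k w) = cnj (h w)" for w
      using k h ker[of w] by (metis fock_inner_kernel_left)
    then show "k = h"
      by auto
  qed (use h in auto)
  then show ?thesis
    by (simp add: adjoint_op_def)
qed

text \<open>Both sides equal \<psi>(w) f(\<phi>(w)) by the reproducing property.\<close>

lemma wcomp_max_adjoint_kernel:
  assumes "f \<in> op_dom (wcomp_max \<psi> \<phi>)"
  shows "fock_inner (op_app (wcomp_max \<psi> \<phi>) f) (fock_kernel w)
    = fock_inner f (\<lambda>z. cnj (\<psi> w) * fock_kernel (\<phi> w) z)"
  using assms
  by (simp add: wcomp_max_def fock_inner_kernel fock_inner_cmult_right) (simp add: wcomp_expr_def)

lemma linear_wcomp_max: "linear_op (wcomp_max \<psi> \<phi>)"
proof -
  have eq: "wcomp_expr \<psi> \<phi> (\<lambda>z. \<alpha> * f z + \<beta> * g z)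
      = (\<lambda>z. \<alpha> * wcomp_expr \<psi> \<phi> f z + \<beta> * wcomp_expr \<psi> \<phi> g z)" for \<alpha> \<beta> f g
    by (simp add: wcomp_expr_def algebra_simps)
  have "(\<lambda>z. 0) \<in> fock"
    by (simp add: fock_iff)
  then show ?thesis
    by (auto simp: linear_op_def wcomp_max_def eq fock_lincomb) (simp add: wcomp_expr_def)
qed

text \<open>For b = 0 and c = 1 the conjugation composes f with the reflection z \<mapsto> cnj (a z)
  and conjugates the value; the reflection preserves both Lebesgue measure and the Gaussian
  weight.\<close>

lemma wcomp_conj_fock:
  assumes a: "norm a = 1" and f: "f \<in> fock"
  shows "wcomp_conj a 0 1 f \<in> fock" "fock_norm (wcomp_conj a 0 1 f) = fock_norm f"
proof -
  define G where "G = (\<lambda>z. (norm (f z))\<^sup>2 * exp (- (norm z)\<^sup>2))"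
  note orth = orthogonal_transformation_reflection[OF a]
  have intG: "integrable lborel G"
    using f by (simp add: G_def fock_iff)
  then have Gm: "G \<in> borel_measurable borel"
    by auto
  have G: "G (cnj (a * z)) = (norm (wcomp_conj a 0 1 f z))\<^sup>2 * exp (- (norm z)\<^sup>2)" for z
    using a by (simp add: G_def wcomp_conj_def norm_mult del: complex_cnj_mult)
  have "(cnj \<circ> f \<circ> cnj) holomorphic_on UNIV"
    using fock_holomorphic[OF f]
    by (intro holomorphic_on_compose_cnj_cnj) (auto intro: holomorphic_on_subset)
  then have "((cnj \<circ> f \<circ> cnj) \<circ> (\<lambda>z. a * z)) holomorphic_on UNIV"
    by (intro holomorphic_on_compose_gen[of _ _ "cnj \<circ> f \<circ> cnj" UNIV] holomorphic_intros) auto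
  then have "wcomp_conj a 0 1 f holomorphic_on UNIV"
    by (simp add: wcomp_conj_def o_def)
  moreover have "integrable lborel (\<lambda>z. (norm (wcomp_conj a 0 1 f z))\<^sup>2 * exp (- (norm z)\<^sup>2))"
    using integrable_orthogonal_complex_iff[OF orth Gm] intG by (simp only: G)
  ultimately show "wcomp_conj a 0 1 f \<in> fock"
    by (simp add: fock_iff)
  have "(LINT z|lborel. (norm (wcomp_conj a 0 1 f z))\<^sup>2 * exp (- (norm z)\<^sup>2)) = (LINT z|lborel. G z)"
    using integral_orthogonal_complex[OF orth Gm] by (simp only: G)
  then show "fock_norm (wcomp_conj a 0 1 f) = fock_norm f"
    unfolding fock_norm_def fock_inner_self by (simp only: G_def)
qed

lemma wcomp_conj_involution:
  assumes "norm a = 1"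
  shows "wcomp_conj a 0 1 (wcomp_conj a 0 1 f) = f"
proof -
  have "cnj a * a = 1"
    using complex_norm_square[of a] assms by (simp add: mult.commute)
  then have "cnj (a * cnj (a * z)) = z" for z
    by (simp flip: mult.assoc)
  then show ?thesis
    by (simp add: wcomp_conj_def del: complex_cnj_mult)
qed

lemma conjugation_wcomp_conj:
  assumes "norm a = 1"
  shows "conjugation (wcomp_conj a 0 1)"
  unfolding conjugation_def
  using wcomp_conj_fock[OF assms] wcomp_conj_involution[OF assms]
  by (auto simp: wcomp_conj_def)

section \<open>Consequences of normality for kernels\<close>

context
  fixes \<psi> \<phi> :: "complex \<Rightarrow> complex"
  assumes normal: "normal_op (wcomp_max \<psi> \<phi>)"
begin

lemma kernel_in_dom: "fock_kernel w \<in> op_dom (wcomp_max \<psi> \<phi>)"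
proof -
  have "fock_kernel w \<in> op_dom (adjoint_op (wcomp_max \<psi> \<phi>))"
    using wcomp_max_adjoint_kernel[of _ \<psi> \<phi> w] fock_cmult[OF fock_kernel_in_fock]
    by (auto simp: adjoint_op_def)
  then show ?thesis
    using normal by (simp add: normal_op_def)
qed

lemma wcomp_kernel_in_fock: "wcomp_expr \<psi> \<phi> (fock_kernel w) \<in> fock"
  using kernel_in_dom[of w] by (simp add: wcomp_max_def)

lemma fock_norm_wcomp_kernel:
  "fock_norm (wcomp_expr \<psi> \<phi> (fock_kernel w)) = norm (\<psi> w) * exp ((norm (\<phi> w))\<^sup>2 / 2)"
proof -
  have "fock_norm (wcomp_expr \<psi> \<phi> (fock_kernel w))
      = fock_norm (op_app (adjoint_op (wcomp_max \<psi> \<phi>)) (fock_kernel w))"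
    using normal kernel_in_dom[of w] by (simp add: normal_op_def) (simp add: wcomp_max_def)
  also have "op_app (adjoint_op (wcomp_max \<psi> \<phi>)) (fock_kernel w)
      = (\<lambda>z. cnj (\<psi> w) * fock_kernel (\<phi> w) z)"
    by (intro adjoint_op_app_eqI kernel_in_dom wcomp_max_adjoint_kernel fock_cmult) auto
  finally show ?thesis
    by (simp add: fock_norm_cmult fock_norm_kernel)
qed

lemma normal_wcomp_bound:
  "norm (\<psi> z) * exp (Re (\<phi> z * cnj w))
     \<le> norm (\<psi> w) * exp ((norm (\<phi> w))\<^sup>2 / 2) * exp ((norm z)\<^sup>2 / 2)"
  using fock_pointwise_bound[OF wcomp_kernel_in_fock, of w z] unfolding fock_norm_wcomp_kernel
  by (simp add: wcomp_expr_def fock_kernel_def norm_mult)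

section \<open>The adjoint and the conjugation for explicit symbols\<close>

context
  fixes A B C D :: complex
  assumes \<phi>: "\<And>z. \<phi> z = A * z + B" and \<psi>: "\<And>z. \<psi> z = C * exp (D * z)"
begin

text \<open>Affine \<phi> and exponential \<psi> send kernels to multiples of kernels, so norms and
  inner products of the images are explicit.\<close>

lemma wcomp_kernel:
  "wcomp_expr \<psi> \<phi> (fock_kernel w) = (\<lambda>z. (C * exp (B * cnj w)) * fock_kernel (cnj A * w + cnj D) z)"
  by (simp add: wcomp_expr_def fock_kernel_def \<phi> \<psi> fun_eq_iff mult.assoc flip: exp_add)
    (simp add: algebra_simps)

text \<open>At w = 0 the norm computed from the explicit image must agree with the norm that
  normality takes from the adjoint.\<close>

lemma norm_symbol_coeffs_eq:
  assumes "C \<noteq> 0"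
  shows "norm B = norm D"
proof -
  have "norm C * exp ((norm D)\<^sup>2 / 2) = norm C * exp ((norm B)\<^sup>2 / 2)"
    using fock_norm_wcomp_kernel[of 0]
    by (simp add: wcomp_kernel fock_norm_cmult fock_norm_kernel norm_mult) (simp add: \<phi> \<psi>)
  then show ?thesis
    using assms by simp
qed

text \<open>The value at w of the adjoint applied to g is the inner product of g with the image of
  the kernel at w, which is again a multiple of a kernel.\<close>

lemma adjoint_wcomp_app:
  assumes "g \<in> op_dom (adjoint_op (wcomp_max \<psi> \<phi>))"
  shows "op_app (adjoint_op (wcomp_max \<psi> \<phi>)) g
      = (\<lambda>w. cnj C * exp (cnj B * w) * g (cnj A * w + cnj D))" (is "?lhs = ?rhs")
    and "op_app (adjoint_op (wcomp_max \<psi> \<phi>)) g \<in> fock"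
proof -
  obtain h where g: "g \<in> fock" and h: "h \<in> fock"
    "\<And>f. f \<in> op_dom (wcomp_max \<psi> \<phi>) \<Longrightarrow> fock_inner (op_app (wcomp_max \<psi> \<phi>) f) g = fock_inner f h"
    using assms by (auto simp: adjoint_op_def)
  have eq: "?lhs = h"
    using h by (intro adjoint_op_app_eqI kernel_in_dom)
  have "h w = ?rhs w" for w
  proof -
    have "h w = cnj (fock_inner (fock_kernel w) h)"
      using h by (simp add: fock_inner_kernel_left)
    also have "\<dots> = cnj (fock_inner (wcomp_expr \<psi> \<phi> (fock_kernel w)) g)"
      using h(2)[OF kernel_in_dom, of w] by (simp add: wcomp_max_def)
    also have "\<dots> = fock_inner g (wcomp_expr \<psi> \<phi> (fock_kernel w))"
      by (rule fock_inner_commute[symmetric])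
    also have "\<dots> = ?rhs w"
      unfolding wcomp_kernel fock_inner_cmult_right fock_inner_kernel[OF g] by (simp add: exp_cnj)
    finally show ?thesis .
  qed
  then show "?lhs = ?rhs" "?lhs \<in> fock"
    using eq h by auto
qed

lemma C_selfadjoint_normal_wcomp:
  assumes a: "norm a = 1" and D: "D = a * B"
  shows "C_selfadjoint (wcomp_conj a 0 1) (wcomp_max \<psi> \<phi>)"
proof -
  let ?T = "wcomp_max \<psi> \<phi>" and ?J = "wcomp_conj a 0 1"
  let ?S = "\<lambda>g w. cnj C * exp (cnj B * w) * g (cnj A * w + cnj D)"
  have dom: "op_dom (adjoint_op ?T) = op_dom ?T"
    using normal by (simp add: normal_op_def)
  have inv: "?J (?J f) = f" for f
    using a by (rule wcomp_conj_involution)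
  have aa: "cnj a * a = 1"
    using complex_norm_square[of a] a by (simp add: mult.commute)
  \<comment> \<open>Because D = a B and |a| = 1, cnj a D = B and a cnj D = cnj B, which matches the
    two affine maps and the two exponents.\<close>
  have comm: "?S (?J f) = ?J (wcomp_expr \<psi> \<phi> f)" for f
  proof
    fix w
    have "cnj (a * (cnj A * w + cnj D)) = A * cnj (a * w) + B"
      using aa by (simp add: D algebra_simps)
    moreover have "cnj (D * cnj (a * w)) = cnj B * w"
      using aa by (simp add: D)
    then have "exp (cnj B * w) = cnj (exp (D * cnj (a * w)))"
      by (simp only: exp_cnj)
    ultimately have "?S (?J f) w
        = cnj C * cnj (exp (D * cnj (a * w))) * cnj (f (A * cnj (a * w) + B))"
      unfolding wcomp_conj_def by (simp only: add_0_right mult_zero_left exp_zero mult_1_left)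
    then show "?S (?J f) w = ?J (wcomp_expr \<psi> \<phi> f) w"
      by (simp add: wcomp_conj_def wcomp_expr_def \<phi> \<psi>)
  qed
  \<comment> \<open>\<open>f \<in> dom T = dom T\<^sup>*\<close> puts \<open>T\<^sup>* f\<close> in the Fock space, and the conjugation carries it to \<open>E(\<psi>, \<phi>)\<close>
    applied to the conjugate of \<open>f\<close>.\<close>
  have J_dom: "?J f \<in> op_dom ?T" if "f \<in> op_dom ?T" for f
  proof -
    have f: "f \<in> fock"
      using that by (simp add: wcomp_max_def)
    have "?S f \<in> fock"
      using adjoint_wcomp_app[of f] that dom by simp
    then have "?J (?S f) \<in> fock"
      by (rule wcomp_conj_fock[OF a])
    moreover have "?J (?S f) = wcomp_expr \<psi> \<phi> (?J f)"
      using comm[of "?J f"] inv by metis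
    ultimately show ?thesis
      using wcomp_conj_fock[OF a f] by (simp add: wcomp_max_def)
  qed
  have "op_eq ?T (conjugate_op ?J (adjoint_op ?T))"
    unfolding op_eq_def
  proof (intro conjI ballI)
    show "op_dom ?T = op_dom (conjugate_op ?J (adjoint_op ?T))"
    proof (intro equalityI subsetI)
      fix f
      assume f: "f \<in> op_dom ?T"
      then have "f \<in> fock"
        by (simp add: wcomp_max_def)
      then show "f \<in> op_dom (conjugate_op ?J (adjoint_op ?T))"
        using J_dom[OF f] dom by (simp add: conjugate_op_def)
    next
      fix f
      assume "f \<in> op_dom (conjugate_op ?J (adjoint_op ?T))"
      then have "?J f \<in> op_dom ?T"
        using dom by (simp add: conjugate_op_def)
      \<comment> \<open>The conjugation is an involution, so invariance of the domain yields this
        inclusion as well.\<close>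
      from J_dom[OF this] show "f \<in> op_dom ?T"
        by (simp add: inv)
    qed
    fix f
    assume "f \<in> op_dom ?T"
    then have "op_app (adjoint_op ?T) (?J f) = ?S (?J f)"
      using adjoint_wcomp_app(1) J_dom dom by blast
    then show "op_app ?T f = op_app (conjugate_op ?J (adjoint_op ?T)) f"
      unfolding conjugate_op_def by (simp add: comm inv) (simp add: wcomp_max_def)
  qed
  then show ?thesis
    using conjugation_wcomp_conj[OF a] linear_wcomp_max normal
    by (simp add: C_selfadjoint_def normal_op_def)
qed

end

end

theorem corollary6p5:
  fixes \<psi> \<phi> :: "complex \<Rightarrow> complex"
  assumes "\<psi> holomorphic_on UNIV" and "\<phi> holomorphic_on UNIV"
    and "\<exists>z. \<psi> z \<noteq> 0"
    and "normal_op (wcomp_max \<psi> \<phi>)"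
  shows "\<exists>A B C D :: complex.
           (\<forall>z. \<phi> z = A * z + B) \<and>
           (\<forall>z. \<psi> z = C * exp (D * z)) \<and>
           ((A \<noteq> 1 \<and> D = cnj B * (1 - A) * inverse (1 - cnj A)) \<or> (A = 1 \<and> norm B = norm D)) \<and>
           (let b = 0; c = 1;
                a = (if B \<noteq> 0 \<and> A \<noteq> 1 then cnj B * (1 - A) * inverse B * inverse (1 - cnj A)
                     else if B \<noteq> 0 \<and> A = 1 then D * inverse B
                     else 1)
            in wcomp_conj_params a b c \<and>
               C_selfadjoint (wcomp_conj a b c) (wcomp_max \<psi> \<phi>))"
proof -
  obtain A B C D where \<phi>: "\<And>z. \<phi> z = A * z + B" and \<psi>: "\<And>z. \<psi> z = C * exp (D * z)"
    and C: "C \<noteq> 0" and rel: "D * (1 - cnj A) = cnj B * (1 - A)"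
    using entire_symbols_affine_exp[OF assms(1-3) normal_wcomp_bound[OF assms(4)]] by blast
  have BD: "norm B = norm D"
    using norm_symbol_coeffs_eq[OF assms(4) \<phi> \<psi> C] .
  have D: "D = cnj B * (1 - A) * inverse (1 - cnj A)" if "A \<noteq> 1"
  proof -
    have "1 - cnj A \<noteq> 0"
      using that by (metis complex_cnj_cnj complex_cnj_one eq_iff_diff_eq_0)
    then show ?thesis
      using rel by (simp add: field_simps)
  qed
  define a where "a = (if B \<noteq> 0 \<and> A \<noteq> 1 then cnj B * (1 - A) * inverse B * inverse (1 - cnj A)
                     else if B \<noteq> 0 \<and> A = 1 then D * inverse B
                     else 1)"
  \<comment> \<open>Both branches with B \<noteq> 0 are D / B, and |B| = |D| gives it modulus 1. For
    B = 0 the same equality forces D = 0, so D = a B also holds with a = 1.\<close>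
  have a: "a = (if B \<noteq> 0 then D * inverse B else 1)"
    using D by (auto simp: a_def)
  then have "norm a = 1" "D = a * B"
    using BD by (auto simp: norm_divide field_simps norm_mult norm_inverse)
  then have "wcomp_conj_params a 0 1 \<and> C_selfadjoint (wcomp_conj a 0 1) (wcomp_max \<psi> \<phi>)"
    using C_selfadjoint_normal_wcomp[OF assms(4) \<phi> \<psi>] by (simp add: wcomp_conj_params_def)
  then show ?thesis
    using \<phi> \<psi> D BD unfolding Let_def a_def by blast
qed

end
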